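(* Consider any financial network with debt contracts only, real (possibly negative) external assets and default costs $\alpha,\beta\in[0,1]$. In the corresponding financial network game under priority-proportional strategies in which firms aim to maximize their equity, every strategy profile is a strong equilibrium.
   Context: Financial network: firms $v_1,\dots,v_n$; each $v_i$ has external assets $e_i\in\mathbb{R}$, possibly negative (a negative value represents an obligation to entities outside the network, which absorbs available funds first); $v_i$ owes $v_j$ the liability $l_{ij}\ge 0$, with $l_{ii}=0$ (both $l_{ij}>0$ and $l_{ji}>0$ are allowed); $L_i=\sum_j l_{ij}$. Default costs $\alpha,\beta\in[0,1]$: a firm in default can use only an $\alpha$ fraction of its external assets (when these are positive) and a $\beta$ fraction of its incoming payments. Priority-proportional strategy: a strategy $s_i$ of $v_i$ is a complete ordering, allowing ties, of its creditors, i.e. an ordered partition of $\{v_j: l_{ij}>0\}$ into priority classes $1,2,\dots$. Write $L_i^{(m)}$ for the total liability of $v_i$ to its $m$-th class, $k_{ij}$ for the index of the class of $v_i$ containing $v_j$, and $\pi'_{ij}=l_{ij}/L_i^{(k_{ij})}$. Clearing payments consistent with a strategy profile $\mathbf{s}=(s_1,\dots,s_n)$: a matrix $\mathbf{P}=(p_{ij})$ with $p_{ii}=0$, $0\le p_{ij}\le l_{ij}$ and, writing $p_i=\sum_j p_{ij}$, for every $i$: $p_i=L_i$ if $L_i\le e_i+\sum_j p_{ji}$ (solvent), and $p_i=\max\{0,\ \alpha\max\{e_i,0\}+\min\{e_i,0\}+\beta\sum_j p_{ji}\}$ otherwise (in default); moreover for every creditor $v_j$ of $v_i$, $$p_{ij}=\min\Big\{\max\Big\{\Big(p_i-\sum_{m=1}^{k_{ij}-1}L_i^{(m)}\Big)\pi'_{ij},\,0\Big\},\,l_{ij}\Big\},$$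 and $p_{ij}=0$ if $l_{ij}=0$. Clearing payments are proper if every firm with a positive outgoing payment is reachable, by a (possibly trivial) directed path of edges $(v_i,v_j)$ with $p_{ij}>0$, from some firm with positive external assets. Only proper clearing payments are considered. For every profile $\mathbf{s}$ there are maximal ones, denoted $\mathbf{P}(\mathbf{s})$, which are entrywise at least as large as all other proper clearing payments consistent with $\mathbf{s}$. Equity: $E_i(\mathbf{P})=\max\{0,\ e_i+\sum_j p_{ji}-L_i\}$. The utility of $v_i$ under $\mathbf{s}$ is $E_i(\mathbf{P}(\mathbf{s}))$. A profile is a strong equilibrium if no non-empty coalition of firms can jointly change their strategies (the other firms' strategies being fixed) so that every member of the coalition obtains strictly greater utility. *)

theory Defs
  imports Complex_Main "HOL-Library.Disjoint_Sets"
begin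

text \<open>
  Financial networks whose only contracts are debts. The firms are the elements of an arbitrary
  finite type; \<open>liab N i j\<close> is the amount \<open>i\<close> owes to \<open>j\<close>.
\<close>

record 'v fin_network =
  ext :: "'v \<Rightarrow> real"
  liab :: "'v \<Rightarrow> 'v \<Rightarrow> real"
  alpha :: real
  beta :: real

definition financial_network :: "'v::finite fin_network \<Rightarrow> bool" where
  "financial_network N \<longleftrightarrow>
     (\<forall>i j. 0 \<le> liab N i j) \<and> (\<forall>i. liab N i i = 0) \<and>
     alpha N \<in> {0..1} \<and> beta N \<in> {0..1}"

definition total_liab :: "'v::finite fin_network \<Rightarrow> 'v \<Rightarrow> real" where
  "total_liab N i = (\<Sum>j\<in>UNIV. liab N i j)"

definition creditors :: "'v::finite fin_network \<Rightarrow> 'v \<Rightarrow> 'v set" where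
  "creditors N i = {j. liab N i j > 0}"

text \<open>
  An ordered partition of the creditors is a duplicate-free list of blocks, highest priority
  first. Since list positions start at 0, the class with 1-based index \<open>m\<close> sits at position
  \<open>m - 1\<close>, and the classes strictly preceding the one at position \<open>k\<close> are those at positions
  \<open>m < k\<close>.
\<close>

type_synonym 'v strategy = "'v set list"

definition strategies :: "'v::finite fin_network \<Rightarrow> 'v \<Rightarrow> 'v strategy set" where
  "strategies N i = {cs. distinct cs \<and> partition_on (creditors N i) (set cs)}"

definition class_liab :: "'v::finite fin_network \<Rightarrow> 'v \<Rightarrow> 'v strategy \<Rightarrow> nat \<Rightarrow> real" where
  "class_liab N i cs m = (\<Sum>j\<in>cs ! m. liab N i j)"

definition class_index :: "'v strategy \<Rightarrow> 'v \<Rightarrow> nat" where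
  "class_index cs j = (THE m. m < length cs \<and> j \<in> cs ! m)"

definition rel_liab :: "'v::finite fin_network \<Rightarrow> 'v \<Rightarrow> 'v strategy \<Rightarrow> 'v \<Rightarrow> real" where
  "rel_liab N i cs j = liab N i j / class_liab N i cs (class_index cs j)"

definition outgoing :: "('v::finite \<Rightarrow> 'v \<Rightarrow> real) \<Rightarrow> 'v \<Rightarrow> real" where
  "outgoing P i = (\<Sum>j\<in>UNIV. P i j)"

definition incoming :: "('v::finite \<Rightarrow> 'v \<Rightarrow> real) \<Rightarrow> 'v \<Rightarrow> real" where
  "incoming P i = (\<Sum>j\<in>UNIV. P j i)"

definition clearing ::
  "'v::finite fin_network \<Rightarrow> ('v \<Rightarrow> 'v strategy) \<Rightarrow> ('v \<Rightarrow> 'v \<Rightarrow> real) \<Rightarrow> bool" where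
  "clearing N s P \<longleftrightarrow>
     (\<forall>i. P i i = 0) \<and>
     (\<forall>i j. 0 \<le> P i j \<and> P i j \<le> liab N i j) \<and>
     (\<forall>i. outgoing P i =
        (if total_liab N i \<le> ext N i + incoming P i then total_liab N i
         else max 0 (alpha N * max (ext N i) 0 + min (ext N i) 0 + beta N * incoming P i))) \<and>
     (\<forall>i. \<forall>j\<in>creditors N i. P i j =
        min (max ((outgoing P i - (\<Sum>m<class_index (s i) j. class_liab N i (s i) m))
                    * rel_liab N i (s i) j) 0)
            (liab N i j)) \<and>
     (\<forall>i j. liab N i j = 0 \<longrightarrow> P i j = 0)"

definition proper :: "'v::finite fin_network \<Rightarrow> ('v \<Rightarrow> 'v \<Rightarrow> real) \<Rightarrow> bool" where
  "proper N P \<longleftrightarrow>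
     (\<forall>i. outgoing P i > 0 \<longrightarrow> (\<exists>k. ext N k > 0 \<and> (\<lambda>u v. P u v > 0)\<^sup>*\<^sup>* k i))"

definition maximal_clearing ::
  "'v::finite fin_network \<Rightarrow> ('v \<Rightarrow> 'v strategy) \<Rightarrow> ('v \<Rightarrow> 'v \<Rightarrow> real) \<Rightarrow> bool" where
  "maximal_clearing N s P \<longleftrightarrow>
     clearing N s P \<and> proper N P \<and>
     (\<forall>Q. clearing N s Q \<and> proper N Q \<longrightarrow> (\<forall>i j. Q i j \<le> P i j))"

text \<open>
  Maximal proper clearing payments are unique by antisymmetry of the entrywise order, so the
  definite description below denotes them as soon as they exist; existence for every strategy
  profile is a theorem, not an assumption.
\<close>

definition clearing_payments ::
  "'v::finite fin_network \<Rightarrow> ('v \<Rightarrow> 'v strategy) \<Rightarrow> ('v \<Rightarrow> 'v \<Rightarrow> real)" where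
  "clearing_payments N s = (THE P. maximal_clearing N s P)"

definition equity :: "'v::finite fin_network \<Rightarrow> ('v \<Rightarrow> 'v \<Rightarrow> real) \<Rightarrow> 'v \<Rightarrow> real" where
  "equity N P i = max 0 (ext N i + incoming P i - total_liab N i)"

definition utility :: "'v::finite fin_network \<Rightarrow> ('v \<Rightarrow> 'v strategy) \<Rightarrow> 'v \<Rightarrow> real" where
  "utility N s i = equity N (clearing_payments N s) i"

definition strategy_profile :: "('v \<Rightarrow> 's set) \<Rightarrow> ('v \<Rightarrow> 's) \<Rightarrow> bool" where
  "strategy_profile S s \<longleftrightarrow> (\<forall>i. s i \<in> S i)"

definition strong_equilibrium ::
  "('v \<Rightarrow> 's set) \<Rightarrow> (('v \<Rightarrow> 's) \<Rightarrow> 'v \<Rightarrow> real) \<Rightarrow> ('v \<Rightarrow> 's) \<Rightarrow> bool" where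
  "strong_equilibrium S u s \<longleftrightarrow>
     strategy_profile S s \<and>
     \<not> (\<exists>C t. C \<noteq> {} \<and> strategy_profile S t \<and> (\<forall>i. i \<notin> C \<longrightarrow> t i = s i) \<and>
             (\<forall>i\<in>C. u t i > u s i))"

end

theory Submission imports Defs begin

text \<open>
  A coalition whose members all gain is, in the maximal clearing payments after the deviation,
  a set of firms with positive equity. Such firms are solvent and pay all their debts, so the order
  in which they pay is irrelevant: those payments are also consistent with the old profile. By
  maximality they lie below the old maximal payments, so no member of the coalition can have gained.

  Existence of maximal proper payments: the clearing payments are the fixed points of a monotone
  map, so there is a greatest one. Let \<open>R\<close> be the firms reachable in it from positive
  external assets. Firms outside \<open>R\<close> receive nothing from \<open>R\<close> and never pay more
  than they receive, so in total they pay nothing to \<open>R\<close>. Hence their payments can be erased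
  without disturbing the firms in \<open>R\<close>, and the result is the greatest proper one.
\<close>

section \<open>Ordered partitions of the creditors\<close>

lemma strategy_class_index:
  assumes "cs \<in> strategies N i" "m < length cs" "j \<in> cs ! m"
  shows "class_index cs j = m"
  unfolding class_index_def
proof (rule the_equality)
  fix k assume k: "k < length cs \<and> j \<in> cs ! k"
  have "disjoint (set cs)" "distinct cs"
    using assms(1) by (auto simp: strategies_def partition_on_def)
  then have "cs ! k = cs ! m"
    using k assms(2,3) by (metis disjnt_iff nth_mem pairwiseD)
  then show "k = m"
    using \<open>distinct cs\<close> k assms(2) by (simp add: nth_eq_iff_index_eq)
qed (use assms in simp)

lemma strategy_class_subset:
  assumes "cs \<in> strategies N i" "m < length cs"
  shows "cs ! m \<subseteq> creditors N i" "cs ! m \<noteq> {}"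
proof -
  have "\<Union> (set cs) = creditors N i" "{} \<notin> set cs"
    using assms(1) by (simp_all add: strategies_def partition_on_def)
  with nth_mem[OF assms(2)] show "cs ! m \<subseteq> creditors N i" "cs ! m \<noteq> {}"
    by (blast, metis)
qed

lemma sum_creditors_classes:
  assumes "cs \<in> strategies N i"
  shows "(\<Sum>j\<in>creditors N i. f j) = (\<Sum>m<length cs. \<Sum>j\<in>cs ! m. f j)"
proof -
  have d: "distinct cs" and p: "partition_on (creditors N i) (set cs)"
    using assms by (auto simp: strategies_def)
  have "(\<Sum>j\<in>creditors N i. f j) = (\<Sum>j\<in>\<Union>(set cs). f j)"
    using p by (simp add: partition_on_def)
  also have "\<dots> = (\<Sum>B\<in>set cs. \<Sum>j\<in>B. f j)"
    using p by (subst sum.Union_disjoint) (auto simp: partition_on_def disjoint_def)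
  also have "\<dots> = (\<Sum>m<length cs. \<Sum>j\<in>cs ! m. f j)"
    by (rule sum.reindex_bij_betw[symmetric]) (rule bij_betw_nth[OF d], auto)
  finally show ?thesis .
qed

text \<open>The right-hand side of the clearing condition on single payments, with a free total
  \<open>p\<close>. For non-creditors \<open>class_index\<close> is unspecified, but the outer
  minimum with a zero liability then gives 0.\<close>

definition allocation ::
  "'v::finite fin_network \<Rightarrow> 'v \<Rightarrow> 'v strategy \<Rightarrow> real \<Rightarrow> 'v \<Rightarrow> real" where
  "allocation N i cs p j =
     min (max ((p - (\<Sum>m<class_index cs j. class_liab N i cs m)) * rel_liab N i cs j) 0)
         (liab N i j)"

definition funds :: "'v::finite fin_network \<Rightarrow> 'v \<Rightarrow> real \<Rightarrow> real" where
  "funds N i x =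
     (if total_liab N i \<le> ext N i + x then total_liab N i
      else max 0 (alpha N * max (ext N i) 0 + min (ext N i) 0 + beta N * x))"

text \<open>\<open>funds\<close> of the incoming payments stands in for \<open>outgoing P\<close>,
  so the map depends on \<open>P\<close> through incoming payments only. The equation for the
  outgoing totals is recovered from the fixed-point equation.\<close>

definition clearing_map ::
  "'v::finite fin_network \<Rightarrow> ('v \<Rightarrow> 'v strategy) \<Rightarrow> ('v \<Rightarrow> 'v \<Rightarrow> real) \<Rightarrow> 'v \<Rightarrow> 'v \<Rightarrow> real" where
  "clearing_map N s P i j = allocation N i (s i) (funds N i (incoming P i)) j"

text \<open>The amount \<open>p\<close> fills containers of capacities \<open>c\<close> in order:
  each term is exactly the growth of the partial sums of \<open>c\<close> truncated at
  \<open>p\<close>.\<close>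

lemma sum_min_max_telescope:
  fixes c :: "nat \<Rightarrow> real"
  assumes "\<And>m. m < n \<Longrightarrow> 0 \<le> c m" "0 \<le> p"
  shows "(\<Sum>m<n. min (max (p - (\<Sum>k<m. c k)) 0) (c m)) = min p (\<Sum>k<n. c k)"
  using assms(1)
proof (induction n)
  case 0
  then show ?case using assms(2) by simp
next
  case (Suc n)
  have "0 \<le> c n" using Suc.prems by simp
  then have "min p (\<Sum>k<n. c k) + min (max (p - (\<Sum>k<n. c k)) 0) (c n) = min p (\<Sum>k<Suc n. c k)"
    by (auto simp: min_def max_def)
  with Suc show ?case by simp
qed

lemma incoming_mono:
  assumes "\<And>i j. P i j \<le> Q i j"
  shows "incoming P i \<le> incoming Q i"
  unfolding incoming_def by (intro sum_mono assms)

lemma incoming_nonneg: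
  assumes "\<And>i j. 0 \<le> P i j"
  shows "0 \<le> incoming P i"
  unfolding incoming_def by (intro sum_nonneg assms)

context
  fixes N :: "'v::finite fin_network"
  assumes network: "financial_network N"
begin

lemma liab_nonneg: "0 \<le> liab N i j"
  and liab_self: "liab N i i = 0"
  and alpha_bounds: "0 \<le> alpha N" "alpha N \<le> 1"
  and beta_bounds: "0 \<le> beta N" "beta N \<le> 1"
  using network by (auto simp: financial_network_def)

lemma total_liab_nonneg: "0 \<le> total_liab N i"
  unfolding total_liab_def by (intro sum_nonneg liab_nonneg)

lemma class_liab_nonneg: "0 \<le> class_liab N i cs m"
  unfolding class_liab_def by (intro sum_nonneg liab_nonneg)

lemma class_liab_pos:
  assumes "cs \<in> strategies N i" "m < length cs"
  shows "0 < class_liab N i cs m"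
  unfolding class_liab_def
  using strategy_class_subset[OF assms] by (intro sum_pos) (auto simp: creditors_def)

lemma sum_creditors:
  assumes "\<And>j. liab N i j = 0 \<Longrightarrow> f j = (0::real)"
  shows "(\<Sum>j\<in>UNIV. f j) = (\<Sum>j\<in>creditors N i. f j)"
proof (rule sum.mono_neutral_right)
  show "\<forall>j\<in>UNIV - creditors N i. f j = 0"
    using assms liab_nonneg by (auto simp: creditors_def order_less_le)
qed auto

lemma total_liab_classes:
  assumes "cs \<in> strategies N i"
  shows "total_liab N i = (\<Sum>m<length cs. class_liab N i cs m)"
  unfolding total_liab_def class_liab_def
  by (subst sum_creditors[of i]) (simp_all add: sum_creditors_classes[OF assms])

lemma rel_liab_nonneg: "0 \<le> rel_liab N i cs j"
  unfolding rel_liab_def by (simp add: liab_nonneg class_liab_nonneg)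

section \<open>Splitting a payment among the creditors\<close>

lemma allocation_nonneg: "0 \<le> allocation N i cs p j"
  unfolding allocation_def using liab_nonneg by simp

lemma allocation_le_liab: "allocation N i cs p j \<le> liab N i j"
  unfolding allocation_def by simp

lemma allocation_no_liab: "liab N i j = 0 \<Longrightarrow> allocation N i cs p j = 0"
  using allocation_nonneg[of i cs p j] allocation_le_liab[of i cs p j] by simp

lemma allocation_mono: "p \<le> q \<Longrightarrow> allocation N i cs p j \<le> allocation N i cs q j"
  unfolding allocation_def
  by (intro min.mono max.mono mult_right_mono rel_liab_nonneg) auto

lemma allocation_zero: "allocation N i cs 0 j = 0"
proof -
  have "0 \<le> (\<Sum>m<class_index cs j. class_liab N i cs m)"
    by (intro sum_nonneg class_liab_nonneg)
  then have "(0 - (\<Sum>m<class_index cs j. class_liab N i cs m)) * rel_liab N i cs j \<le> 0"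
    using rel_liab_nonneg by (simp add: mult_nonneg_nonneg)
  then show ?thesis
    unfolding allocation_def using liab_nonneg by (simp add: max_def)
qed

lemma sum_allocation_class:
  assumes cs: "cs \<in> strategies N i" and m: "m < length cs"
  shows "(\<Sum>j\<in>cs ! m. allocation N i cs p j) =
    min (max (p - (\<Sum>k<m. class_liab N i cs k)) 0) (class_liab N i cs m)"
proof -
  define c where "c = class_liab N i cs m"
  define d where "d = p - (\<Sum>k<m. class_liab N i cs k)"
  have c: "0 < c" using class_liab_pos[OF cs m] by (simp add: c_def)
  \<comment> \<open>Within one class all creditors receive the same fraction of their
    claims.\<close>
  have "allocation N i cs p j = liab N i j * min (max (d / c) 0) 1" if "j \<in> cs ! m" for j
  proof -
    have "allocation N i cs p j = min (max (d * (liab N i j / c)) 0) (liab N i j)"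
      using strategy_class_index[OF cs m that]
      by (simp add: allocation_def rel_liab_def c_def d_def)
    also have "d * (liab N i j / c) = liab N i j * (d / c)" by simp
    finally show ?thesis
      using liab_nonneg[of i j] by (simp add: min_mult_distrib_left max_mult_distrib_left)
  qed
  then have "(\<Sum>j\<in>cs ! m. allocation N i cs p j) = c * min (max (d / c) 0) 1"
    by (simp add: c_def class_liab_def sum_distrib_right)
  also have "\<dots> = min (max d 0) c"
    using c by (simp add: min_mult_distrib_left max_mult_distrib_left)
  finally show ?thesis by (simp add: c_def d_def)
qed

text \<open>The payment fills the classes one after another; as it does not exceed their total
  capacity, nothing is left over.\<close>

lemma sum_allocation:
  assumes cs: "cs \<in> strategies N i" and p: "0 \<le> p" "p \<le> total_liab N i"
  shows "(\<Sum>j\<in>UNIV. allocation N i cs p j) = p"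
proof -
  have "(\<Sum>j\<in>UNIV. allocation N i cs p j) =
    (\<Sum>m<length cs. \<Sum>j\<in>cs ! m. allocation N i cs p j)"
    by (subst sum_creditors[of i]) (simp_all add: allocation_no_liab sum_creditors_classes[OF cs])
  also have "\<dots> = min p (\<Sum>m<length cs. class_liab N i cs m)"
    using p by (simp add: sum_allocation_class[OF cs] sum_min_max_telescope class_liab_nonneg)
  finally show ?thesis
    using p by (simp add: total_liab_classes[OF cs])
qed

text \<open>The shortfalls are nonnegative and, by \<open>sum_allocation\<close>, sum to zero. Hence
  priorities do not affect a firm that pays in full.\<close>

lemma allocation_total:
  assumes "cs \<in> strategies N i"
  shows "allocation N i cs (total_liab N i) j = liab N i j"
proof -
  have "(\<Sum>j\<in>UNIV. liab N i j - allocation N i cs (total_liab N i) j) = 0"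
    using sum_allocation[OF assms total_liab_nonneg order_refl]
    by (simp add: sum_subtractf total_liab_def)
  then show ?thesis
    by (subst (asm) sum_nonneg_eq_0_iff) (auto simp: allocation_le_liab)
qed

section \<open>Total payment of a firm as a function of its income\<close>

lemma default_value_le:
  assumes "0 \<le> x"
  shows "alpha N * max (ext N i) 0 + min (ext N i) 0 + beta N * x \<le> ext N i + x"
proof -
  have "alpha N * max (ext N i) 0 \<le> max (ext N i) 0"
    using alpha_bounds by (intro mult_left_le_one_le) auto
  moreover have "beta N * x \<le> x"
    using beta_bounds assms by (intro mult_left_le_one_le) auto
  ultimately show ?thesis by linarith
qed

lemma funds_nonneg: "0 \<le> funds N i x"
  unfolding funds_def using total_liab_nonneg by simp

lemma funds_le_total: "0 \<le> x \<Longrightarrow> funds N i x \<le> total_liab N i"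
  unfolding funds_def using total_liab_nonneg[of i] default_value_le[of x i] by auto

text \<open>Below the solvency threshold \<open>funds\<close> is affine with slope
  \<open>beta N\<close>, truncated at 0. The jump at the threshold goes upward by
  \<open>funds_le_total\<close>.\<close>

lemma funds_mono:
  assumes "0 \<le> x" "x \<le> y"
  shows "funds N i x \<le> funds N i y"
proof (cases "total_liab N i \<le> ext N i + y")
  case True
  then show ?thesis using funds_le_total[OF assms(1), of i] by (simp add: funds_def)
next
  case False
  have "beta N * x \<le> beta N * y"
    using assms beta_bounds by (intro mult_left_mono)
  with False assms show ?thesis by (auto simp: funds_def)
qed

text \<open>Without positive external assets, income is the only source of money. This drives the
  flow balance in \<open>maximal_clearing_exists\<close>.\<close>

lemma funds_le_incoming:
  assumes "0 \<le> x" "ext N i \<le> 0"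
  shows "funds N i x \<le> x"
  unfolding funds_def using default_value_le[OF assms(1), of i] assms by auto

section \<open>The clearing map and its fixed points\<close>

lemma clearing_map_nonneg: "0 \<le> clearing_map N s P i j"
  unfolding clearing_map_def by (rule allocation_nonneg)

lemma clearing_map_le_liab: "clearing_map N s P i j \<le> liab N i j"
  unfolding clearing_map_def by (rule allocation_le_liab)

lemma clearing_map_mono:
  assumes "\<And>i j. 0 \<le> P i j" "\<And>i j. P i j \<le> Q i j"
  shows "clearing_map N s P i j \<le> clearing_map N s Q i j"
  unfolding clearing_map_def
  by (intro allocation_mono funds_mono incoming_nonneg incoming_mono assms)

lemma clearing_outgoing:
  assumes "clearing N s P"
  shows "outgoing P i = funds N i (incoming P i)"
  using assms unfolding clearing_def funds_def by blast

text \<open>For the converse, \<open>sum_allocation\<close> shows that the row sums of a fixed point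
  are the \<open>funds\<close>, which is the condition on outgoing payments.\<close>

lemma clearing_iff_fixpoint:
  assumes s: "strategy_profile (strategies N) s"
  shows "clearing N s P \<longleftrightarrow> clearing_map N s P = P"
proof
  assume c: "clearing N s P"
  have "clearing_map N s P i j = P i j" for i j
  proof (cases "liab N i j = 0")
    case True
    with c show ?thesis
      by (simp add: clearing_map_def allocation_no_liab clearing_def)
  next
    case False
    then have "j \<in> creditors N i"
      using liab_nonneg[of i j] by (simp add: creditors_def)
    with c have "P i j = allocation N i (s i) (outgoing P i) j"
      unfolding clearing_def allocation_def by blast
    then show ?thesis
      by (simp add: clearing_map_def clearing_outgoing[OF c])
  qed
  then show "clearing_map N s P = P" by blast
next
  assume fp: "clearing_map N s P = P"
  have nonneg: "0 \<le> P i j" and le: "P i j \<le> liab N i j" for i j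
    using clearing_map_nonneg[of s P i j] clearing_map_le_liab[of s P i j] by (simp_all add: fp)
  have alloc: "P i j = allocation N i (s i) (funds N i (incoming P i)) j" for i j
    using fp by (metis clearing_map_def)
  have out: "outgoing P i = funds N i (incoming P i)" for i
  proof -
    have "outgoing P i = (\<Sum>j\<in>UNIV. allocation N i (s i) (funds N i (incoming P i)) j)"
      unfolding outgoing_def by (intro sum.cong refl alloc)
    also have "\<dots> = funds N i (incoming P i)"
      using s by (intro sum_allocation funds_nonneg funds_le_total incoming_nonneg nonneg)
        (simp add: strategy_profile_def)
    finally show ?thesis .
  qed
  show "clearing N s P"
    unfolding clearing_def
  proof (intro conjI allI ballI impI)
    show "P i i = 0" for i
      using nonneg[of i i] le[of i i] by (simp add: liab_self)
    show "P i j = 0" if "liab N i j = 0" for i j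
      using nonneg[of i j] le[of i j] that by simp
    show "outgoing P i = (if total_liab N i \<le> ext N i + incoming P i then total_liab N i
        else max 0 (alpha N * max (ext N i) 0 + min (ext N i) 0 + beta N * incoming P i))" for i
      using out[of i] by (simp only: funds_def)
    show "P i j = min (max ((outgoing P i - (\<Sum>m<class_index (s i) j. class_liab N i (s i) m))
                    * rel_liab N i (s i) j) 0) (liab N i j)" for i j
      using alloc[of i j] by (simp only: out allocation_def)
  qed (use nonneg le in auto)
qed

text \<open>The Knaster-Tarski argument: the entrywise supremum of the post-fixed points is the
  greatest fixed point.\<close>

lemma greatest_clearing_exists:
  assumes s: "strategy_profile (strategies N) s"
  obtains P where "clearing N s P" "\<And>Q i j. clearing N s Q \<Longrightarrow> Q i j \<le> P i j"
proof -
  let ?F = "clearing_map N s"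
  \<comment> \<open>Nonnegativity is imposed because \<open>clearing_map_mono\<close> is available
    only above the zero matrix.\<close>
  define S where "S = {Q. (\<forall>i j. 0 \<le> Q i j) \<and> (\<forall>i j. Q i j \<le> ?F Q i j)}"
  define P where "P i j = (SUP Q\<in>S. Q i j)" for i j
  have "(\<lambda>_ _. 0) \<in> S"
    by (simp add: S_def clearing_map_nonneg)
  then have ne: "S \<noteq> {}" by blast
  have bdd: "bdd_above ((\<lambda>Q. Q i j) ` S)" for i j
  proof (rule bdd_aboveI2)
    fix Q assume "Q \<in> S"
    then have "Q i j \<le> ?F Q i j" by (simp add: S_def)
    then show "Q i j \<le> liab N i j"
      using clearing_map_le_liab by (rule order_trans)
  qed
  have up: "Q i j \<le> P i j" if "Q \<in> S" for Q i j
    unfolding P_def using that bdd by (rule cSUP_upper)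
  have P0: "0 \<le> P i j" for i j
    using up[OF \<open>(\<lambda>_ _. 0) \<in> S\<close>] by simp
  have le: "P i j \<le> ?F P i j" for i j
    unfolding P_def[of i j]
  proof (rule cSUP_least[OF ne])
    fix Q assume Q: "Q \<in> S"
    then have "Q i j \<le> ?F Q i j" by (simp add: S_def)
    also have "\<dots> \<le> ?F P i j"
      using Q by (intro clearing_map_mono up) (auto simp: S_def)
    finally show "Q i j \<le> ?F P i j" .
  qed
  \<comment> \<open>Applying the map to \<open>le\<close> makes \<open>?F P\<close> itself
    post-fixed, so it lies below the supremum \<open>P\<close>.\<close>
  have "?F P \<in> S"
    using clearing_map_mono[OF P0 le] by (simp add: S_def clearing_map_nonneg)
  then have "?F P = P"
    using le up by (intro ext) (meson order_antisym)
  then have "clearing N s P"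
    by (simp add: clearing_iff_fixpoint[OF s])
  moreover have "Q i j \<le> P i j" if "clearing N s Q" for Q i j
  proof (rule up)
    have "?F Q = Q" using that by (simp add: clearing_iff_fixpoint[OF s])
    with that show "Q \<in> S" by (simp add: S_def clearing_def)
  qed
  ultimately show ?thesis using that by blast
qed

section \<open>Greatest proper clearing payments\<close>

lemma maximal_clearing_exists:
  assumes s: "strategy_profile (strategies N) s"
  obtains P where "maximal_clearing N s P"
proof -
  obtain P where c: "clearing N s P" and great: "\<And>Q i j. clearing N s Q \<Longrightarrow> Q i j \<le> P i j"
    using greatest_clearing_exists[OF s] by blast
  have P0: "0 \<le> P i j" for i j
    using c by (simp add: clearing_def)
  define R where "R = {i. \<exists>k. ext N k > 0 \<and> (\<lambda>u v. P u v > 0)\<^sup>*\<^sup>* k i}"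
  define Q where "Q i j = (if i \<in> R then P i j else 0)" for i j
  have closed: "P i j = 0" if "i \<in> R" "j \<notin> R" for i j
  proof (rule ccontr)
    assume "P i j \<noteq> 0"
    then have "P i j > 0" using P0[of i j] by simp
    with \<open>i \<in> R\<close> have "j \<in> R"
      unfolding R_def by (blast intro: rtranclp.rtrancl_into_rtrancl)
    with that show False by simp
  qed
  have ext_outside: "ext N i \<le> 0" if "i \<notin> R" for i
    using that unfolding R_def by (auto simp: not_less[symmetric])
  have into_R: "P i j = 0" if "i \<notin> R" "j \<in> R" for i j
  proof -
    have "(\<Sum>i\<in>-R. outgoing P i) \<le> (\<Sum>i\<in>-R. incoming P i)"
      using ext_outside
      by (intro sum_mono) (simp add: clearing_outgoing[OF c] funds_le_incoming incoming_nonneg P0)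
    \<comment> \<open>Since \<open>R\<close> pays nothing outward, income outside \<open>R\<close>
      comes from outside \<open>R\<close>. These internal flows cancel against the internal part of
      the outgoing sums, leaving only the payments into \<open>R\<close>.\<close>
    also have "\<dots> = (\<Sum>i\<in>-R. \<Sum>j\<in>-R. P j i)"
      unfolding incoming_def by (intro sum.cong refl sum.mono_neutral_right) (auto simp: closed)
    also have "\<dots> = (\<Sum>i\<in>-R. \<Sum>j\<in>-R. P i j)"
      by (rule sum.swap)
    finally have "(\<Sum>i\<in>-R. \<Sum>j\<in>UNIV. P i j) \<le> (\<Sum>i\<in>-R. \<Sum>j\<in>-R. P i j)"
      by (simp only: outgoing_def)
    moreover have "(\<Sum>j\<in>UNIV. P i j) = (\<Sum>j\<in>R. P i j) + (\<Sum>j\<in>-R. P i j)" for i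
      by (simp add: Compl_eq_Diff_UNIV sum.subset_diff[of R UNIV])
    ultimately have "(\<Sum>i\<in>-R. \<Sum>j\<in>R. P i j) \<le> 0"
      by (simp add: sum.distrib)
    then have "(\<Sum>i\<in>-R. \<Sum>j\<in>R. P i j) = 0"
      by (intro antisym sum_nonneg P0)
    then show ?thesis
      using that by (simp add: sum_nonneg_eq_0_iff sum_nonneg P0)
  qed
  have inc_R: "incoming Q i = incoming P i" if "i \<in> R" for i
    unfolding incoming_def Q_def using that by (intro sum.cong) (auto simp: into_R)
  have inc_outside: "incoming Q i = 0" if "i \<notin> R" for i
    unfolding incoming_def Q_def using that by (intro sum.neutral) (auto simp: closed)
  have "clearing_map N s Q i j = Q i j" for i j
  proof (cases "i \<in> R")
    case True
    have "clearing_map N s P i j = P i j"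
      using c by (simp add: clearing_iff_fixpoint[OF s])
    with True show ?thesis by (simp add: clearing_map_def inc_R Q_def)
  next
    case False
    \<comment> \<open>With neither income nor positive external assets a firm pays nothing, so the
      erased rows are consistent.\<close>
    have "funds N i 0 = 0"
      using funds_le_incoming[OF order_refl ext_outside[OF False]] funds_nonneg[of i 0] by simp
    with False show ?thesis
      by (simp add: clearing_map_def inc_outside allocation_zero Q_def)
  qed
  then have "clearing N s Q"
    using clearing_iff_fixpoint[OF s] by blast
  moreover have "proper N Q"
    unfolding proper_def
  proof (intro allI impI)
    fix i assume "outgoing Q i > 0"
    then have "i \<in> R"
      by (cases "i \<in> R") (simp_all add: outgoing_def Q_def)
    then obtain k where k: "ext N k > 0" and path: "(\<lambda>u v. P u v > 0)\<^sup>*\<^sup>* k i"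
      by (auto simp: R_def)
    \<comment> \<open>The path never leaves \<open>R\<close>, where the rows of \<open>Q\<close> and
      \<open>P\<close> agree.\<close>
    from path have "(\<lambda>u v. Q u v > 0)\<^sup>*\<^sup>* k i"
    proof induction
      case (step u v)
      have "u \<in> R" using k step.hyps(1) by (auto simp: R_def)
      with step.hyps(2) have "Q u v > 0" by (simp add: Q_def)
      with step.IH show ?case by (rule rtranclp.rtrancl_into_rtrancl)
    qed simp
    with k show "\<exists>k. ext N k > 0 \<and> (\<lambda>u v. Q u v > 0)\<^sup>*\<^sup>* k i" by blast
  qed
  moreover have "Q' i j \<le> Q i j" if c': "clearing N s Q'" and "proper N Q'" for Q' i j
  proof (cases "i \<in> R")
    case True
    then show ?thesis using great[OF c'] by (simp add: Q_def)
  next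
    case False
    \<comment> \<open>As \<open>Q'\<close> lies below \<open>P\<close>, a path witnessing properness
      of \<open>Q'\<close> is also a path in \<open>P\<close> and would put \<open>i\<close> into
      \<open>R\<close>.\<close>
    have "\<not> outgoing Q' i > 0"
    proof
      assume "outgoing Q' i > 0"
      then obtain k where "ext N k > 0" and path: "(\<lambda>u v. Q' u v > 0)\<^sup>*\<^sup>* k i"
        using \<open>proper N Q'\<close> unfolding proper_def by blast
      moreover have "(\<lambda>u v. P u v > 0)\<^sup>*\<^sup>* k i"
        using path by (rule rtranclp_mono[THEN predicate2D, rotated])
          (use great[OF c'] in \<open>auto intro: less_le_trans\<close>)
      ultimately show False using False by (auto simp: R_def)
    qed
    moreover have "Q' i j \<le> outgoing Q' i"
      unfolding outgoing_def using c' by (intro member_le_sum) (auto simp: clearing_def)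
    ultimately show ?thesis using False by (simp add: Q_def)
  qed
  ultimately have "maximal_clearing N s Q"
    by (simp add: maximal_clearing_def)
  then show ?thesis by (rule that)
qed

section \<open>Maximal payments under a change of strategies\<close>

lemma maximal_clearing_payments:
  assumes s: "strategy_profile (strategies N) s"
  shows "maximal_clearing N s (clearing_payments N s)"
proof -
  obtain P where P: "maximal_clearing N s P"
    using maximal_clearing_exists[OF s] .
  moreover have "Q = P" if "maximal_clearing N s Q" for Q
    using that P by (intro ext) (meson maximal_clearing_def order_antisym)
  ultimately show ?thesis
    unfolding clearing_payments_def by (rule theI)
qed

text \<open>A solvent firm has \<open>funds\<close> equal to its total liability, so by
  \<open>allocation_total\<close> both strategies yield the same row. The two clearing maps thus
  agree at \<open>P\<close>.\<close>

lemma clearing_change_strategies: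
  assumes c: "clearing N t P"
    and s: "strategy_profile (strategies N) s" and t: "strategy_profile (strategies N) t"
    and same: "\<And>i. s i = t i \<or> total_liab N i \<le> ext N i + incoming P i"
  shows "clearing N s P"
proof -
  have "clearing_map N s P i j = clearing_map N t P i j" for i j
    using same[of i] s t
    by (auto simp: clearing_map_def funds_def allocation_total strategy_profile_def)
  then have "clearing_map N s P = clearing_map N t P" by blast
  with c show ?thesis
    by (simp add: clearing_iff_fixpoint[OF s] clearing_iff_fixpoint[OF t])
qed

end

theorem theorem12:
  fixes N :: "'v::finite fin_network" and s :: "'v \<Rightarrow> 'v strategy"
  assumes "financial_network N"
    and "strategy_profile (strategies N) s"
  shows "strong_equilibrium (strategies N) (utility N) s"
  unfolding strong_equilibrium_def
proof (intro conjI notI)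
  assume "\<exists>C t. C \<noteq> {} \<and> strategy_profile (strategies N) t \<and> (\<forall>i. i \<notin> C \<longrightarrow> t i = s i) \<and>
             (\<forall>i\<in>C. utility N t i > utility N s i)"
  then obtain C t where "C \<noteq> {}" and t: "strategy_profile (strategies N) t"
    and same: "\<And>i. i \<notin> C \<Longrightarrow> t i = s i"
    and better: "\<And>i. i \<in> C \<Longrightarrow> utility N t i > utility N s i"
    by blast
  let ?P = "clearing_payments N s" and ?Q = "clearing_payments N t"
  note maxP = maximal_clearing_payments[OF assms]
  note maxQ = maximal_clearing_payments[OF assms(1) t]
  have "s i = t i \<or> total_liab N i \<le> ext N i + incoming ?Q i" for i
  proof (cases "i \<in> C")
    case True
    \<comment> \<open>Equity is never negative, so a strict gain makes the new equity positive,
      which forces solvency.\<close>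
    then show ?thesis using better[of i] by (auto simp: utility_def equity_def)
  qed (simp add: same)
  moreover have "clearing N t ?Q"
    using maxQ by (simp add: maximal_clearing_def)
  ultimately have "clearing N s ?Q"
    using clearing_change_strategies[OF assms(1) _ assms(2) t] by blast
  \<comment> \<open>\<open>proper\<close> does not refer to the strategies, so \<open>?Q\<close>
    competes with \<open>?P\<close> under \<open>s\<close>.\<close>
  then have "?Q i j \<le> ?P i j" for i j
    using maxP maxQ by (simp add: maximal_clearing_def)
  then have "utility N t i \<le> utility N s i" for i
    using incoming_mono[of ?Q ?P i] by (simp add: utility_def equity_def)
  then show False
    using \<open>C \<noteq> {}\<close> better by (metis ex_in_conv leD)
qed (rule assms)

end
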